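(* Let $G$ be a group, let $H$ and $K$ be normal subgroups of $G$, and let $n \ge 1$ be an integer. Then, in the semiring of normal subgroups of $G$, $$(H+K)^n = \sum_{s \subseteq \{0,\dots,n-1\}} \mathrm{factor}(H,K,n,s),$$ where the sum runs over all subsets $s$ of $\{0,\dots,n-1\}$.
   Context: The set of normal subgroups of $G$ is equipped with the operations $A + B := A \sqcup B$ (the subgroup generated by $A$ and $B$) and $A\,B := [A,B]$ (the subgroup generated by all commutators $a b a^{-1} b^{-1}$ with $a \in A$, $b \in B$), and with zero element $0 := \{1\}$. These form a non-unital, commutative, not necessarily associative semiring; the finite sum denotes the iterated $+$, i.e. the join. Positive powers are defined iteratively by $A^1 = A$ and $A^{m+1} = A^m\,A$ for $m \ge 1$. For $n \ge 1$ and $s \subseteq \{0,\dots,n-1\}$, $\mathrm{factor}(H,K,n,s)$ is the product of length $n$ built by iteratively multiplying by $H$ or $K$ in each slot: put $X_i = H$ if $i \in s$ and $X_i = K$ if $i \notin s$, for $0 \le i \le n-1$; then $\mathrm{factor}(H,K,n,s) = (\cdots((X_0\,X_1)\,X_2)\cdots)\,X_{n-1}$ (equal to $X_0$ when $n=1$). *)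

theory Defs
  imports "HOL-Algebra.Algebra"
begin

definition join_subgroup :: "('a, 'b) monoid_scheme \<Rightarrow> 'a set \<Rightarrow> 'a set \<Rightarrow> 'a set" where
  "join_subgroup G A B = generate G (A \<union> B)"

definition commutator_subgroup :: "('a, 'b) monoid_scheme \<Rightarrow> 'a set \<Rightarrow> 'a set \<Rightarrow> 'a set" where
  "commutator_subgroup G A B =
     generate G (\<Union>a \<in> A. \<Union>b \<in> B. { a \<otimes>\<^bsub>G\<^esub> b \<otimes>\<^bsub>G\<^esub> (inv\<^bsub>G\<^esub> a) \<otimes>\<^bsub>G\<^esub> (inv\<^bsub>G\<^esub> b) })"

text \<open>The ring record is used only as a signature. The semiring has no unit and its product is
  in general not associative, so the field one is unspecified and the library power, which starts
  from one, is not used. Only the additive part is a monoid, which is what finsum needs.\<close>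

definition normal_semiring :: "('a, 'b) monoid_scheme \<Rightarrow> 'a set ring" where
  "normal_semiring G =
     \<lparr> carrier = {N. N \<lhd> G}, monoid.mult = commutator_subgroup G, one = undefined,
       ring.zero = {\<one>\<^bsub>G\<^esub>}, add = join_subgroup G \<rparr>"

text \<open>Powers and products of length 0 do not exist in a non-unital semiring; both functions below
  are unspecified there.\<close>

primrec pos_power :: "('a, 'b) ring_scheme \<Rightarrow> 'a \<Rightarrow> nat \<Rightarrow> 'a" where
  "pos_power R a 0 = undefined"
| "pos_power R a (Suc m) = (if m = 0 then a else pos_power R a m \<otimes>\<^bsub>R\<^esub> a)"

primrec HK_factor :: "('a, 'b) ring_scheme \<Rightarrow> 'a \<Rightarrow> 'a \<Rightarrow> nat \<Rightarrow> nat set \<Rightarrow> 'a" where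
  "HK_factor R h k 0 s = undefined"
| "HK_factor R h k (Suc m) s =
     (let x = (if m \<in> s then h else k) in if m = 0 then x else HK_factor R h k m s \<otimes>\<^bsub>R\<^esub> x)"

context group
begin

lemma join_subgroup_eq_set_mult:
  assumes "A \<lhd> G" "B \<lhd> G"
  shows "join_subgroup G A B = A <#> B"
proof
  interpret A: normal A G by fact
  interpret B: normal B G by fact
  have sub: "subgroup (A <#> B) G"
    using mult_norm_subgroup[OF assms(1) B.subgroup_axioms] .
  have "a \<otimes> \<one> \<in> A <#> B" if "a \<in> A" for a
    unfolding set_mult_def using that B.one_closed by blast
  moreover have "\<one> \<otimes> b \<in> A <#> B" if "b \<in> B" for b
    unfolding set_mult_def using that A.one_closed by blast
  ultimately have "A \<union> B \<subseteq> A <#> B"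
    using A.mem_carrier B.mem_carrier by fastforce
  then show "join_subgroup G A B \<subseteq> A <#> B"
    unfolding join_subgroup_def by (rule generate_subgroup_incl[OF _ sub])
  show "A <#> B \<subseteq> join_subgroup G A B"
    unfolding join_subgroup_def set_mult_def by (auto intro: generate.eng generate.incl)
qed

lemma join_subgroup_normal:
  assumes "A \<lhd> G" "B \<lhd> G"
  shows "join_subgroup G A B \<lhd> G"
  unfolding join_subgroup_def
proof (rule normal_generateI)
  show "A \<union> B \<subseteq> carrier G"
    using assms by (simp add: normal_imp_subgroup subgroup.subset)
  show "g \<otimes> h \<otimes> inv g \<in> A \<union> B" if "h \<in> A \<union> B" "g \<in> carrier G" for h g
    using that normal.inv_op_closed2[OF assms(1)] normal.inv_op_closed2[OF assms(2)] by auto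
qed

text \<open>This justifies writing the sum as finsum, which is independent of the order of summation
  only in an abelian monoid.\<close>

lemma abelian_monoid_normal_semiring: "abelian_monoid (normal_semiring G)"
proof (rule abelian_monoidI)
  fix A B C
  assume "A \<in> carrier (normal_semiring G)" "B \<in> carrier (normal_semiring G)"
    "C \<in> carrier (normal_semiring G)"
  then have n: "A \<lhd> G" "B \<lhd> G" "C \<lhd> G" by (auto simp: normal_semiring_def)
  then have c: "A \<subseteq> carrier G" "B \<subseteq> carrier G" "C \<subseteq> carrier G"
    by (simp_all add: normal_imp_subgroup subgroup.subset)
  show "A \<oplus>\<^bsub>normal_semiring G\<^esub> B \<oplus>\<^bsub>normal_semiring G\<^esub> C =
      A \<oplus>\<^bsub>normal_semiring G\<^esub> (B \<oplus>\<^bsub>normal_semiring G\<^esub> C)"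
    using join_subgroup_eq_set_mult[OF n(1,2)] join_subgroup_eq_set_mult[OF n(2,3)]
      join_subgroup_eq_set_mult[OF join_subgroup_normal[OF n(1,2)] n(3)]
      join_subgroup_eq_set_mult[OF n(1) join_subgroup_normal[OF n(2,3)]]
    by (simp add: normal_semiring_def set_mult_assoc[OF c])
next
  fix A assume "A \<in> carrier (normal_semiring G)"
  then have n: "A \<lhd> G" by (simp add: normal_semiring_def)
  then interpret A: normal A G .
  have "generate G (insert \<one> A) = A"
    using generateI[OF A.subgroup_axioms order.refl] A.one_closed by (simp add: insert_absorb)
  then show "\<zero>\<^bsub>normal_semiring G\<^esub> \<oplus>\<^bsub>normal_semiring G\<^esub> A = A"
    by (simp add: normal_semiring_def join_subgroup_def)
next
  show "A \<oplus>\<^bsub>normal_semiring G\<^esub> B = B \<oplus>\<^bsub>normal_semiring G\<^esub> A" for A B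
    by (simp add: normal_semiring_def join_subgroup_def Un_commute)
next
  show "\<zero>\<^bsub>normal_semiring G\<^esub> \<in> carrier (normal_semiring G)"
    using one_is_normal by (simp add: normal_semiring_def)
next
  fix A B assume "A \<in> carrier (normal_semiring G)" "B \<in> carrier (normal_semiring G)"
  then show "A \<oplus>\<^bsub>normal_semiring G\<^esub> B \<in> carrier (normal_semiring G)"
    using join_subgroup_normal by (simp add: normal_semiring_def)
qed

lemma commutator_subgroup_normal:
  assumes "A \<lhd> G" "B \<lhd> G"
  shows "commutator_subgroup G A B \<lhd> G"
  unfolding commutator_subgroup_def
proof (rule normal_generateI)
  interpret A: normal A G by fact
  interpret B: normal B G by fact
  show "(\<Union>a\<in>A. \<Union>b\<in>B. {a \<otimes> b \<otimes> inv a \<otimes> inv b}) \<subseteq> carrier G"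
    using A.subset B.subset by auto
  fix h g assume "h \<in> (\<Union>a\<in>A. \<Union>b\<in>B. {a \<otimes> b \<otimes> inv a \<otimes> inv b})" and g: "g \<in> carrier G"
  then obtain a b where ab: "a \<in> A" "b \<in> B" and h: "h = a \<otimes> b \<otimes> inv a \<otimes> inv b" by auto
  have c: "a \<in> carrier G" "b \<in> carrier G" using ab A.subset B.subset by auto
  let ?a = "g \<otimes> a \<otimes> inv g" and ?b = "g \<otimes> b \<otimes> inv g"
  have can: "inv g \<otimes> (g \<otimes> x) = x" if "x \<in> carrier G" for x
    using that g by (simp add: m_assoc[symmetric])
  have "g \<otimes> h \<otimes> inv g = ?a \<otimes> ?b \<otimes> inv ?a \<otimes> inv ?b"
    using c g by (simp add: h m_assoc inv_mult_group can)
  moreover have "?a \<in> A" "?b \<in> B"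
    using ab g A.inv_op_closed2 B.inv_op_closed2 by auto
  ultimately show "g \<otimes> h \<otimes> inv g \<in> (\<Union>a\<in>A. \<Union>b\<in>B. {a \<otimes> b \<otimes> inv a \<otimes> inv b})" by blast
qed

end

end

theory Submission
  imports Defs
begin

text \<open>
  The theorem is the noncommutative binomial expansion: multiplying out \<open>(h + k)\<^sup>n\<close> selects \<open>h\<close> or
  \<open>k\<close> in each of the \<open>n\<close> slots, and \<open>s\<close> is the set of slots in which \<open>h\<close> is selected. As powers
  are bracketed to the left in the same way as the products \<open>HK_factor\<close>, no associativity is
  needed, only the two distributive laws (\<open>binomial_expansion\<close>).

  So all the group theory is in \<open>[A \<squnion> B, C] = [A, C] \<squnion> [B, C]\<close> for normal subgroups
  (\<open>commutator_join_left\<close>). Elements of \<open>A \<squnion> B\<close> are products \<open>ab\<close>, and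
  \<open>[ab, c] = a [b, c] a\<^sup>-\<^sup>1 \<cdot> [a, c]\<close>, where the conjugate stays in \<open>[B, C]\<close> because that subgroup
  is normal. The law in the other argument follows by \<open>[A, B] = [B, A]\<close>, which holds because
  \<open>[a, b]\<^sup>-\<^sup>1 = [b, a]\<close>.
\<close>

section \<open>The binomial expansion in a nonassociative semiring\<close>

locale nonassoc_semiring = abelian_monoid R for R (structure) +
  assumes mult_closed: "\<lbrakk> x \<in> carrier R; y \<in> carrier R \<rbrakk> \<Longrightarrow> x \<otimes> y \<in> carrier R"
    and l_distr: "\<lbrakk> x \<in> carrier R; y \<in> carrier R; z \<in> carrier R \<rbrakk>
      \<Longrightarrow> (x \<oplus> y) \<otimes> z = x \<otimes> z \<oplus> y \<otimes> z"
    and r_distr: "\<lbrakk> x \<in> carrier R; y \<in> carrier R; z \<in> carrier R \<rbrakk>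
      \<Longrightarrow> z \<otimes> (x \<oplus> y) = z \<otimes> x \<oplus> z \<otimes> y"
    and l_null: "x \<in> carrier R \<Longrightarrow> \<zero> \<otimes> x = \<zero>"
begin

lemma finsum_mult_right:
  assumes "finite I" "f \<in> I \<rightarrow> carrier R" "x \<in> carrier R"
  shows "(\<Oplus>i\<in>I. f i) \<otimes> x = (\<Oplus>i\<in>I. f i \<otimes> x)"
  using assms
proof (induction I rule: finite_induct)
  case empty
  then show ?case by (simp add: l_null)
next
  case (insert i I)
  have f: "f \<in> I \<rightarrow> carrier R" "f i \<in> carrier R" using insert.prems by auto
  have fx: "(\<lambda>i. f i \<otimes> x) \<in> I \<rightarrow> carrier R" "f i \<otimes> x \<in> carrier R"
    using f insert.prems mult_closed by auto
  show ?case
    using insert.IH insert.hyps insert.prems f fx by (simp add: l_distr)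
qed

lemma HK_factor_closed:
  assumes "h \<in> carrier R" "k \<in> carrier R" "m \<ge> 1"
  shows "HK_factor R h k m s \<in> carrier R"
  using \<open>m \<ge> 1\<close>
  by (induction m rule: dec_induct) (use assms in \<open>auto simp: Let_def intro: mult_closed\<close>)

lemma HK_factor_cong:
  assumes "s \<inter> {0..<m} = t \<inter> {0..<m}"
  shows "HK_factor R h k m s = HK_factor R h k m t"
  using assms
proof (induction m)
  case (Suc m)
  have "(m \<in> s) = (m \<in> t)" "s \<inter> {0..<m} = t \<inter> {0..<m}"
    using Suc.prems by (auto simp: set_eq_iff less_Suc_eq)
  with Suc.IH show ?case by (simp add: Let_def)
qed simp

text \<open>One more factor \<open>h + k\<close> splits each summand in two, just as the subsets of \<open>{0..<m + 1}\<close> are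
  the subsets of \<open>{0..<m}\<close> with and without \<open>m\<close>. The induction starts at one because powers of
  exponent zero do not exist.\<close>

lemma binomial_expansion:
  assumes h: "h \<in> carrier R" and k: "k \<in> carrier R" and "n \<ge> 1"
  shows "pos_power R (h \<oplus> k) n = (\<Oplus>s \<in> Pow {0..<n}. HK_factor R h k n s)"
  using \<open>n \<ge> 1\<close>
proof (induction n rule: dec_induct)
  case base
  have "Pow {0..<1::nat} = {{0}, {}}" by (auto simp: Pow_insert)
  then show ?case using h k by simp
next
  case (step m)
  let ?F = "HK_factor R h k m" and ?P = "Pow {0..<m}"
  have F: "?F s \<in> carrier R" for s
    using HK_factor_closed h k step.hyps by simp
  have fresh: "m \<notin> s" if "s \<in> ?P" for s using that by auto
  have F_insert: "?F (insert m s) = ?F s" for s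
    by (rule HK_factor_cong) auto
  have inj: "inj_on (insert m) ?P"
    using fresh by (meson inj_onI insert_ident)
  have Suc_F: "HK_factor R h k (Suc m) s = ?F s \<otimes> (if m \<in> s then h else k)" for s
    using step.hyps by (simp add: Let_def)
  have closed: "HK_factor R h k (Suc m) s \<in> carrier R" for s
    using HK_factor_closed[OF h k] by (simp del: HK_factor.simps)
  have "pos_power R (h \<oplus> k) (Suc m) = (\<Oplus>s\<in>?P. ?F s) \<otimes> (h \<oplus> k)"
    using step by simp
  also have "\<dots> = (\<Oplus>s\<in>?P. ?F s) \<otimes> h \<oplus> (\<Oplus>s\<in>?P. ?F s) \<otimes> k"
    using F h k by (simp add: r_distr)
  also have "\<dots> = (\<Oplus>s\<in>?P. ?F s \<otimes> h) \<oplus> (\<Oplus>s\<in>?P. ?F s \<otimes> k)"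
    using F h k by (simp add: finsum_mult_right)
  also have "(\<Oplus>s\<in>?P. ?F s \<otimes> h) = (\<Oplus>s\<in>?P. HK_factor R h k (Suc m) (insert m s))"
    by (rule finsum_cong') (auto simp del: HK_factor.simps simp: Suc_F F_insert F h mult_closed)
  also have "\<dots> = (\<Oplus>s\<in>insert m ` ?P. HK_factor R h k (Suc m) s)"
    using closed by (intro finsum_reindex[symmetric] inj) auto
  also have "(\<Oplus>s\<in>?P. ?F s \<otimes> k) = (\<Oplus>s\<in>?P. HK_factor R h k (Suc m) s)"
    by (rule finsum_cong') (use fresh in \<open>auto simp: Suc_F F k mult_closed simp del: HK_factor.simps\<close>)
  also have "(\<Oplus>s\<in>insert m ` ?P. HK_factor R h k (Suc m) s) \<oplus>
      (\<Oplus>s\<in>?P. HK_factor R h k (Suc m) s) =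
      (\<Oplus>s\<in>insert m ` ?P \<union> ?P. HK_factor R h k (Suc m) s)"
    by (rule finsum_Un_disjoint[symmetric]) (use fresh closed in auto)
  also have "insert m ` ?P \<union> ?P = Pow {0..<Suc m}"
    by (simp add: atLeast0_lessThan_Suc Pow_insert Un_commute)
  finally show ?case .
qed

end

section \<open>Distributivity of commutators over joins\<close>

context group
begin

lemma commutator_mem:
  "\<lbrakk> a \<in> A; b \<in> B \<rbrakk> \<Longrightarrow> a \<otimes> b \<otimes> inv a \<otimes> inv b \<in> commutator_subgroup G A B"
  unfolding commutator_subgroup_def by (rule generate.incl) blast

lemma commutator_subgroup_least:
  assumes "subgroup N G"
    and "\<And>a b. \<lbrakk> a \<in> A; b \<in> B \<rbrakk> \<Longrightarrow> a \<otimes> b \<otimes> inv a \<otimes> inv b \<in> N"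
  shows "commutator_subgroup G A B \<subseteq> N"
  unfolding commutator_subgroup_def
  by (rule generate_subgroup_incl) (use assms in auto)

lemma commutator_subgroup_mono:
  assumes "A \<subseteq> A'" "B \<subseteq> B'"
  shows "commutator_subgroup G A B \<subseteq> commutator_subgroup G A' B'"
  unfolding commutator_subgroup_def using assms by (intro mono_generate) blast

lemma commutator_subgroup_commute_le:
  assumes "A \<lhd> G" "B \<lhd> G"
  shows "commutator_subgroup G A B \<subseteq> commutator_subgroup G B A"
proof (rule commutator_subgroup_least)
  show sub: "subgroup (commutator_subgroup G B A) G"
    using assms commutator_subgroup_normal normal_imp_subgroup by blast
  fix a b assume ab: "a \<in> A" "b \<in> B"
  then have "a \<in> carrier G" "b \<in> carrier G"
    using assms normal_imp_subgroup subgroup.mem_carrier by metis+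
  then have "a \<otimes> b \<otimes> inv a \<otimes> inv b = inv (b \<otimes> a \<otimes> inv b \<otimes> inv a)"
    by (simp add: inv_mult_group m_assoc)
  then show "a \<otimes> b \<otimes> inv a \<otimes> inv b \<in> commutator_subgroup G B A"
    using subgroup.m_inv_closed[OF sub commutator_mem[OF ab(2,1)]] by simp
qed

lemma commutator_subgroup_commute:
  assumes "A \<lhd> G" "B \<lhd> G"
  shows "commutator_subgroup G A B = commutator_subgroup G B A"
  using assms commutator_subgroup_commute_le by blast

lemma commutator_subgroup_trivial:
  assumes "A \<lhd> G"
  shows "commutator_subgroup G {\<one>} A = {\<one>}"
proof -
  interpret A: normal A G by fact
  have "commutator_subgroup G {\<one>} A \<subseteq> {\<one>}"
    by (rule commutator_subgroup_least[OF triv_subgroup]) auto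
  then show ?thesis
    unfolding commutator_subgroup_def using generate.one by blast
qed

text \<open>Normality is used twice: it makes \<open>A \<squnion> B\<close> the set of products \<open>ab\<close>, so that commutators of
  longer words do not arise, and it absorbs the conjugation by \<open>a\<close> in the expansion of \<open>[ab, c]\<close>.\<close>

lemma commutator_join_left:
  assumes "A \<lhd> G" "B \<lhd> G" "C \<lhd> G"
  shows "commutator_subgroup G (join_subgroup G A B) C =
    join_subgroup G (commutator_subgroup G A C) (commutator_subgroup G B C)"
    (is "?L = join_subgroup G ?AC ?BC")
proof
  interpret A: normal A G by fact
  interpret B: normal B G by fact
  interpret C: normal C G by fact
  interpret AC: normal ?AC G by (rule commutator_subgroup_normal) fact+
  interpret BC: normal ?BC G by (rule commutator_subgroup_normal) fact+
  have join_normal: "join_subgroup G ?AC ?BC \<lhd> G"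
    by (rule join_subgroup_normal) unfold_locales
  show "?L \<subseteq> join_subgroup G ?AC ?BC"
  proof (rule commutator_subgroup_least)
    show "subgroup (join_subgroup G ?AC ?BC) G"
      using join_normal normal_imp_subgroup by blast
    fix x c assume "x \<in> join_subgroup G A B" and c: "c \<in> C"
    then obtain a b where ab: "a \<in> A" "b \<in> B" and x: "x = a \<otimes> b"
      unfolding join_subgroup_eq_set_mult[OF assms(1,2)] set_mult_def by auto
    have cl: "a \<in> carrier G" "b \<in> carrier G" "c \<in> carrier G" using ab c by auto
    have can: "inv c \<otimes> (c \<otimes> y) = y" "inv a \<otimes> (a \<otimes> y) = y" if "y \<in> carrier G" for y
      using that cl by (simp_all add: m_assoc[symmetric])
    have "x \<otimes> c \<otimes> inv x \<otimes> inv c =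
        (a \<otimes> (b \<otimes> c \<otimes> inv b \<otimes> inv c) \<otimes> inv a) \<otimes> (a \<otimes> c \<otimes> inv a \<otimes> inv c)"
      using cl by (simp add: x m_assoc inv_mult_group can)
    moreover have "a \<otimes> (b \<otimes> c \<otimes> inv b \<otimes> inv c) \<otimes> inv a \<in> ?BC"
      using BC.inv_op_closed2[OF cl(1) commutator_mem[OF ab(2) c]] .
    ultimately show "x \<otimes> c \<otimes> inv x \<otimes> inv c \<in> join_subgroup G ?AC ?BC"
      unfolding join_subgroup_def using commutator_mem[OF ab(1) c]
      by (metis UnI1 UnI2 generate.eng generate.incl)
  qed
  have "A \<union> B \<subseteq> join_subgroup G A B"
    unfolding join_subgroup_def by (auto intro: generate.incl)
  then have "?AC \<union> ?BC \<subseteq> ?L"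
    by (simp add: commutator_subgroup_mono)
  moreover have "subgroup ?L G"
    using assms commutator_subgroup_normal join_subgroup_normal normal_imp_subgroup by blast
  ultimately show "join_subgroup G ?AC ?BC \<subseteq> ?L"
    unfolding join_subgroup_def[of G ?AC ?BC] by (rule generate_subgroup_incl)
qed

lemma nonassoc_semiring_normal_semiring: "nonassoc_semiring (normal_semiring G)"
proof (intro nonassoc_semiring.intro abelian_monoid_normal_semiring
    nonassoc_semiring_axioms.intro)
  fix A B C
  assume "A \<in> carrier (normal_semiring G)" "B \<in> carrier (normal_semiring G)"
    "C \<in> carrier (normal_semiring G)"
  then have n: "A \<lhd> G" "B \<lhd> G" "C \<lhd> G" by (auto simp: normal_semiring_def)
  show "(A \<oplus>\<^bsub>normal_semiring G\<^esub> B) \<otimes>\<^bsub>normal_semiring G\<^esub> C =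
      A \<otimes>\<^bsub>normal_semiring G\<^esub> C \<oplus>\<^bsub>normal_semiring G\<^esub> B \<otimes>\<^bsub>normal_semiring G\<^esub> C"
    using commutator_join_left[OF n] by (simp add: normal_semiring_def)
  show "C \<otimes>\<^bsub>normal_semiring G\<^esub> (A \<oplus>\<^bsub>normal_semiring G\<^esub> B) =
      C \<otimes>\<^bsub>normal_semiring G\<^esub> A \<oplus>\<^bsub>normal_semiring G\<^esub> C \<otimes>\<^bsub>normal_semiring G\<^esub> B"
    using commutator_join_left[OF n] commutator_subgroup_commute[OF n(3)] n
      join_subgroup_normal[OF n(1,2)]
    by (simp add: normal_semiring_def)
qed (simp_all add: normal_semiring_def commutator_subgroup_normal commutator_subgroup_trivial)

end

theorem mainTheorem3:
  fixes G :: "('a, 'b) monoid_scheme"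
    and H K :: "'a set"
    and n :: nat
  assumes "group G"
    and "H \<lhd> G"
    and "K \<lhd> G"
    and "n \<ge> 1"
  shows "pos_power (normal_semiring G) (H \<oplus>\<^bsub>normal_semiring G\<^esub> K) n =
    (\<Oplus>\<^bsub>normal_semiring G\<^esub> s \<in> Pow {0..<n}. HK_factor (normal_semiring G) H K n s)"
proof -
  interpret nonassoc_semiring "normal_semiring G"
    using assms(1) by (rule group.nonassoc_semiring_normal_semiring)
  show ?thesis
    using assms by (intro binomial_expansion) (simp_all add: normal_semiring_def)
qed

end
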